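(* Let $ABC$ be a triangle with $AB=AC$, let $D$ be a point in the interior of side $AC$ and $E$ a point in the interior of side $AB$. Put $a=\angle BAC$, $b=\angle DBC$, $c=\angle ECB$ and $\theta=\angle EDB$. Suppose that $a$, $b$ and $c$ are each an integral number of degrees. If $\theta$ is a rational number of degrees, then, writing this rational number in lowest terms, its denominator is at most $2$.
   Context: All angles are ordinary (unsigned) angles of a Euclidean plane triangle configuration, measured in degrees. Since $D$ and $E$ are interior to the sides, $0<b,c<90^\circ-\tfrac{a}{2}$. *)

theory Defs
  imports "HOL-Analysis.Analysis"
begin

text \<open>
  The unsigned angle \<open>\<angle>PQR\<close> at the vertex \<open>Q\<close>, in degrees, with values in \<open>[0, 180]\<close>.
  It is meaningful for \<open>P \<noteq> Q\<close> and \<open>R \<noteq> Q\<close>; by the convention \<open>x / 0 = 0\<close> it is 90 otherwise.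
\<close>

definition angle_deg :: "'a::real_inner \<Rightarrow> 'a \<Rightarrow> 'a \<Rightarrow> real" where
  "angle_deg P Q R =
     arccos (((P - Q) \<bullet> (R - Q)) / (norm (P - Q) * norm (R - Q))) * 180 / pi"

end

theory Submission
  imports Defs "HOL-Computational_Algebra.Polynomial_Factorial" "HOL-Library.Real_Mod"
begin

text \<open>
  With all angles in radians, eliminating the positions of \<open>D\<close> and \<open>E\<close> turns the configuration into
  \<open>Im (cis \<theta> * W) = 0\<close>, where \<open>W\<close> is a signed sum of six terms \<open>cis\<close> of integral linear combinations
  of \<open>a\<close>, \<open>b\<close>, \<open>c\<close>; hence \<open>cis (2 * \<theta>) * W = cnj W\<close>. Since \<open>W \<noteq> 0\<close>, the number \<open>cis (2 * \<theta>)\<close> lies in the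
  cyclotomic field generated by the 360th roots of unity. As 360 is even, the only roots of unity in
  this field are the 360th ones, so \<open>2 * \<theta>\<close> is an integral number of degrees. The last fact about cyclotomic
  fields follows from the irreducibility of cyclotomic polynomials, in the form that an integer
  polynomial vanishing at an \<open>n\<close>-th root of unity \<open>\<zeta>\<close> vanishes at \<open>\<zeta> ^ k\<close> for \<open>k\<close> coprime to \<open>n\<close>.
\<close>

section \<open>Evaluation of integer polynomials\<close>

definition ieval :: "int poly \<Rightarrow> 'a::comm_ring_1 \<Rightarrow> 'a" where
  "ieval P x = poly (map_poly of_int P) x"

lemma ieval_0 [simp]: "ieval 0 x = 0"
  by (simp add: ieval_def)

lemma ieval_pCons [simp]: "ieval (pCons a P) x = of_int a + x * ieval P x"
  by (simp add: ieval_def map_poly_pCons)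

lemma ieval_add [simp]: "ieval (P + Q) x = ieval P x + ieval Q x"
  by (induction P Q rule: poly_induct2) (simp_all add: algebra_simps)

lemma ieval_smult [simp]: "ieval (smult a P) x = of_int a * ieval P x"
  by (induction P) (simp_all add: algebra_simps)

lemma ieval_mult [simp]: "ieval (P * Q) x = ieval P x * ieval Q x"
  by (induction P) (simp_all add: algebra_simps)

lemma ieval_1 [simp]: "ieval 1 x = 1"
  by (simp add: one_pCons)

lemma ieval_uminus [simp]: "ieval (- P) x = - ieval P x"
  using ieval_smult[of "-1" P x] by simp

lemma ieval_diff [simp]: "ieval (P - Q) x = ieval P x - ieval Q x"
  using ieval_add[of P "- Q" x] by simp

lemma ieval_power [simp]: "ieval (P ^ n) x = ieval P x ^ n"
  by (induction n) simp_all

lemma ieval_monom [simp]: "ieval (monom a n) x = of_int a * x ^ n"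
  by (induction n) (simp_all add: monom_0 monom_Suc algebra_simps)

lemma ieval_of_nat [simp]: "ieval (of_nat n) x = of_nat n"
  by (simp add: of_nat_poly)

lemma ieval_pcompose [simp]: "ieval (P \<circ>\<^sub>p Q) x = ieval P (ieval Q x)"
  by (induction P) (simp_all add: pcompose_pCons)

section \<open>The Frobenius congruence modulo a prime\<close>

lemma prime_dvd_add_power_diff:
  fixes u v :: "'a::comm_ring_1"
  assumes "prime p"
  shows "of_nat p dvd (u + v) ^ p - (u ^ p + v ^ p)"
proof -
  have p: "p > 1" using assms prime_gt_1_nat by blast
  have eq: "{..p} = insert 0 (insert p {0<..<p})" using p by auto
  have "(u + v) ^ p - (u ^ p + v ^ p) =
      (\<Sum>k\<in>{0<..<p}. of_nat (p choose k) * u ^ k * v ^ (p - k))"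
    using p by (simp add: binomial_ring eq)
  moreover have "of_nat p dvd (of_nat (p choose k) * u ^ k * v ^ (p - k) :: 'a)"
    if "k \<in> {0<..<p}" for k
  proof -
    have "p dvd p choose k" using that assms by (intro dvd_choose_prime) auto
    then obtain q where "p choose k = p * q" by blast
    then show ?thesis by (simp add: mult.assoc)
  qed
  ultimately show ?thesis by (simp only: dvd_sum)
qed

lemma prime_dvd_power_diff_int:
  assumes "prime p"
  shows "int p dvd a ^ p - a"
proof (induction a rule: int_induct[where k = 0])
  case base
  then show ?case using assms by (simp add: power_0_left prime_gt_0_nat)
next
  case (step1 a)
  have "int p dvd (a + 1) ^ p - (a ^ p + 1 ^ p)"
    using prime_dvd_add_power_diff[OF assms, of a 1] by simp
  from dvd_add[OF this step1.IH] show ?case by (simp add: algebra_simps)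
next
  case (step2 a)
  have "int p dvd a ^ p - ((a - 1) ^ p + 1)"
    using prime_dvd_add_power_diff[OF assms, of "a - 1" 1] by simp
  from dvd_diff[OF step2.IH this] show ?case by (simp add: algebra_simps)
qed

text \<open>Splitting off the constant term, \<open>prime_dvd_add_power_diff\<close> removes the
  mixed terms of the \<open>p\<close>-th power modulo \<open>p\<close>, and Fermat's little theorem
  treats the constant.\<close>

lemma prime_dvd_pcompose_diff:
  fixes P :: "int poly"
  assumes "prime p"
  shows "of_nat p dvd P ^ p - P \<circ>\<^sub>p monom 1 p"
proof (induction P)
  case 0
  then show ?case using assms by (simp add: power_0_left prime_gt_0_nat)
next
  case (pCons a P)
  let ?X = "monom 1 1 :: int poly"
  have 0: "pCons a P = [:a:] + ?X * P" by (simp add: monom_altdef)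
  have 1: "of_nat p dvd ([:a:] + ?X * P) ^ p - ([:a:] ^ p + (?X * P) ^ p)"
    by (rule prime_dvd_add_power_diff[OF assms])
  have 2: "of_nat p dvd [:a:] ^ p - [:a:]"
  proof -
    obtain q where "a ^ p - a = int p * q" using prime_dvd_power_diff_int[OF assms] by blast
    then have "[:a:] ^ p - [:a:] = of_nat p * [:q:]"
      by (simp add: poly_const_pow of_nat_poly)
    then show ?thesis by (rule dvdI)
  qed
  have 3: "of_nat p dvd monom 1 p * (P ^ p - P \<circ>\<^sub>p monom 1 p)"
    by (rule dvd_mult[OF pCons.IH])
  have "pCons a P ^ p - pCons a P \<circ>\<^sub>p monom 1 p =
      (([:a:] + ?X * P) ^ p - ([:a:] ^ p + (?X * P) ^ p)) + ([:a:] ^ p - [:a:]) +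
      monom 1 p * (P ^ p - P \<circ>\<^sub>p monom 1 p)"
    unfolding 0[symmetric]
    by (simp add: pcompose_pCons power_mult_distrib monom_power algebra_simps)
  then show ?case using 1 2 3 by (metis dvd_add)
qed

section \<open>Primitive minimal polynomials\<close>

lemma primitive_dvd_smultD:
  fixes f P :: "int poly"
  assumes "content f = 1" "c \<noteq> 0" "f dvd smult c P"
  shows "f dvd P"
proof -
  obtain h where h: "smult c P = f * h" using assms(3) by blast
  \<comment> \<open>By Gauss's lemma contents multiply, so \<open>c\<close> divides every
    coefficient of \<open>h\<close> and cancels.\<close>
  have "normalize c * content P = content h"
    using arg_cong[OF h, of content] assms(1) by (simp add: content_mult)
  then have "c dvd content h" by (metis dvd_triv_left normalize_dvd_iff)
  then have "[:c:] dvd h" by (simp add: const_poly_dvd_iff_dvd_content)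
  then obtain h' where "h = [:c:] * h'" by (rule dvdE)
  then have "h = smult c h'" by simp
  then have "smult c P = smult c (f * h')" using h by simp
  then have "P = f * h'" using assms(2) by (metis smult_cancel)
  then show ?thesis by simp
qed

text \<open>An annihilating polynomial of least degree, made primitive, works: the pseudo-remainder
  of any other one vanishes by minimality, and the power of the leading coefficient brought in by
  pseudo-division is cancelled by \<open>primitive_dvd_smultD\<close>.\<close>

lemma primitive_minimal_polynomial:
  fixes x :: complex and P :: "int poly"
  assumes "P \<noteq> 0" "ieval P x = 0"
  obtains f :: "int poly" where "f \<noteq> 0" "ieval f x = 0" "\<And>Q. ieval Q x = 0 \<Longrightarrow> f dvd Q"
proof -
  define S where "S = (\<lambda>Q :: int poly. Q \<noteq> 0 \<and> ieval Q x = 0)"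
  obtain g where g: "S g" "\<And>Q. S Q \<Longrightarrow> degree g \<le> degree Q"
    using ex_has_least_nat[of S P degree] assms unfolding S_def by blast
  define f where "f = primitive_part g"
  have gf: "g = smult (content g) f" by (simp add: f_def)
  have g0: "g \<noteq> 0" "ieval g x = 0" using g(1) by (auto simp: S_def)
  have c: "content g \<noteq> 0" using g0 by simp
  have "of_int (content g) * ieval f x = 0"
    using g0(2) gf ieval_smult by metis
  then have f: "f \<noteq> 0" "ieval f x = 0" "content f = 1" "degree f = degree g"
    using g0(1) c by (simp_all add: f_def)
  have "f dvd Q" if Q: "ieval Q x = 0" for Q
  proof -
    obtain q r where qr: "pseudo_divmod Q f = (q, r)" by force
    note pd = pseudo_divmod[OF f(1) qr]
    let ?c = "coeff f (degree f) ^ (Suc (degree Q) - degree f)"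
    have "ieval r x = 0"
      using arg_cong[OF pd(1), of "\<lambda>P. ieval P x"] Q f(2) by simp
    then have "r = 0" using pd(2) g(2)[of r] f(4) unfolding S_def by linarith
    then have "f dvd smult ?c Q" using pd(1) by simp
    moreover have "?c \<noteq> 0" using f(1) by simp
    ultimately show ?thesis using primitive_dvd_smultD f(3) by blast
  qed
  then show thesis by (rule that[OF f(1,2)])
qed

text \<open>Degrees add modulo \<open>p\<close>: the leading terms of \<open>f\<close> and of
  \<open>A\<close> modulo \<open>p\<close> give a nonzero coefficient of \<open>f * A\<close> in
  positive degree, where all coefficients of \<open>1 - smult p B\<close> are multiples of
  \<open>p\<close>.\<close>

lemma not_unit_mod_prime:
  fixes f :: "int poly" and p :: int
  assumes p: "prime p" and lc: "\<not> p dvd lead_coeff f" and d: "degree f > 0"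
  shows "\<not> f dvd 1 - smult p B"
proof
  assume "f dvd 1 - smult p B"
  then obtain A where A: "1 - smult p B = f * A" by blast
  define S where "S = {i. \<not> p dvd coeff A i}"
  have "S \<subseteq> {..degree A}" by (auto simp: S_def intro: le_degree)
  then have fin: "finite S" using finite_subset by blast
  have "S \<noteq> {}"
  proof
    assume "S = {}"
    then have "p dvd coeff f 0 * coeff A 0" by (auto simp: S_def)
    moreover have "coeff f 0 * coeff A 0 = 1 - p * coeff B 0"
      using arg_cong[OF A, of "\<lambda>P. coeff P 0"] by (simp add: coeff_mult)
    ultimately have "p dvd 1 - p * coeff B 0 + p * coeff B 0" by (metis dvd_add dvd_triv_left)
    then show False using p by (simp add: not_prime_unit)
  qed
  define k where "k = Max S"
  have k: "\<not> p dvd coeff A k" using Max_in[OF fin \<open>S \<noteq> {}\<close>] by (simp add: k_def S_def)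
  have gt: "p dvd coeff A i" if "i > k" for i
    using Max_ge[OF fin, of i] that unfolding k_def S_def by fastforce
  let ?d = "degree f"
  have "coeff (f * A) (?d + k) = (\<Sum>i\<le>?d + k. coeff f i * coeff A (?d + k - i))"
    by (simp add: coeff_mult)
  also have "\<dots> = lead_coeff f * coeff A k +
      (\<Sum>i\<in>{..?d + k} - {?d}. coeff f i * coeff A (?d + k - i))"
    by (subst sum.remove[of _ ?d]) auto
  finally have eq: "coeff (f * A) (?d + k) - (\<Sum>i\<in>{..?d + k} - {?d}. coeff f i * coeff A (?d + k - i))
      = lead_coeff f * coeff A k" by simp
  have 1: "p dvd (\<Sum>i\<in>{..?d + k} - {?d}. coeff f i * coeff A (?d + k - i))"
  proof (rule dvd_sum)
    fix i assume i: "i \<in> {..?d + k} - {?d}"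
    show "p dvd coeff f i * coeff A (?d + k - i)"
    proof (cases "i < ?d")
      case True
      then show ?thesis using gt[of "?d + k - i"] by simp
    next
      case False
      then show ?thesis using i by (simp add: coeff_eq_0)
    qed
  qed
  have 2: "p dvd coeff (f * A) (?d + k)"
    unfolding A[symmetric] using d by simp
  have "p dvd lead_coeff f * coeff A k" using dvd_diff[OF 2 1] eq by simp
  then show False using p lc k prime_dvd_mult_iff by blast
qed

section \<open>Conjugates of roots of unity\<close>

lemma conjugate_root_prime:
  fixes \<zeta> :: complex
  assumes p: "prime p" "\<not> p dvd n" and n: "n > 0" "\<zeta> ^ n = 1" and P: "ieval P \<zeta> = 0"
  shows "ieval P (\<zeta> ^ p) = 0"
proof -
  let ?U = "monom 1 n - 1 :: int poly"
  have cU: "coeff ?U n = 1" using n by simp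
  then have "?U \<noteq> 0" by force
  moreover have U0: "ieval ?U \<zeta> = 0" using n by simp
  ultimately obtain f where f: "f \<noteq> 0" "ieval f \<zeta> = 0"
      "\<And>Q. ieval Q \<zeta> = 0 \<Longrightarrow> f dvd Q"
    by (rule primitive_minimal_polynomial) auto
  obtain g where g: "?U = f * g" using f(3)[OF U0] by blast
  have df: "degree f > 0"
  proof (rule ccontr)
    assume "\<not> degree f > 0"
    then obtain c where "f = [:c:]" by (metis degree_eq_zeroE not_gr_zero)
    then show False using f by simp
  qed
  \<comment> \<open>Since \<open>?U\<close> is monic, the leading coefficient of its factor
    \<open>f\<close> is a unit, so \<open>f\<close> keeps its degree modulo
    \<open>p\<close>.\<close>
  have "degree ?U = n"
    by (rule antisym[OF _ le_degree]) (use cU n in \<open>auto intro!: degree_diff_le simp: degree_monom_le\<close>)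
  then have "lead_coeff ?U = 1" using cU by metis
  then have "lead_coeff f dvd 1" unfolding g by (metis dvd_triv_left lead_coeff_mult)
  then have lc: "\<not> int p dvd lead_coeff f"
    using p by (meson dvd_trans not_prime_unit prime_nat_int_transfer)
  txt \<open>
    If \<open>f (\<zeta>\<^sup>p) \<noteq> 0\<close>, then \<open>g (\<zeta>\<^sup>p) = 0\<close>, so the Frobenius congruence puts \<open>g (\<zeta>)\<^sup>p\<close> into \<open>p\<int>[\<zeta>]\<close>.
    Differentiating \<open>X\<^sup>n - 1 = f g\<close> at \<open>\<zeta>\<close> shows that \<open>g (\<zeta>)\<close> divides \<open>n\<close>, whence \<open>n\<^sup>p \<in> p\<int>[\<zeta>]\<close> although
    \<open>p\<close> does not divide \<open>n\<close>.
  \<close>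
  have "ieval f (\<zeta> ^ p) = 0"
  proof (rule ccontr)
    assume nz: "ieval f (\<zeta> ^ p) \<noteq> 0"
    have "ieval f (\<zeta> ^ p) * ieval g (\<zeta> ^ p) = ieval ?U (\<zeta> ^ p)" by (simp add: g)
    also have "\<dots> = 0" using n by (simp add: mult.commute flip: power_mult) (simp add: power_mult)
    finally have g0: "ieval g (\<zeta> ^ p) = 0" using nz by simp
    obtain R where "g ^ p - g \<circ>\<^sub>p monom 1 p = of_nat p * R"
      using prime_dvd_pcompose_diff[OF p(1)] by blast
    from arg_cong[OF this, of "\<lambda>P. ieval P \<zeta>"] g0
    have gp: "ieval g \<zeta> ^ p = of_nat p * ieval R \<zeta>" by simp
    have "pderiv ?U = pderiv f * g + f * pderiv g" by (simp add: g pderiv_mult mult.commute add.commute)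
    from arg_cong[OF this, of "\<lambda>P. ieval P \<zeta>"] f(2)
    have "of_nat n * \<zeta> ^ (n - 1) = ieval (pderiv f) \<zeta> * ieval g \<zeta>"
      by (simp add: pderiv_diff pderiv_monom)
    then have "of_nat n * \<zeta> ^ (n - 1) * \<zeta> = ieval (pderiv f) \<zeta> * \<zeta> * ieval g \<zeta>"
      by (simp only: mult_ac)
    moreover have "\<zeta> ^ (n - 1) * \<zeta> = 1" using n by (metis power_minus_mult)
    ultimately have "of_nat n = ieval (pderiv f) \<zeta> * \<zeta> * ieval g \<zeta>"
      by (metis mult.assoc mult.right_neutral)
    then have "of_nat n ^ p = (ieval (pderiv f) \<zeta> * \<zeta>) ^ p * (of_nat p * ieval R \<zeta>)"
      by (simp add: power_mult_distrib gp)
    then have np: "of_nat (n ^ p) = of_nat p * ieval ((pderiv f * monom 1 1) ^ p * R) \<zeta>"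
      by (simp add: algebra_simps)
    \<comment> \<open>Bezout yields an integer polynomial \<open>B\<close> with
      \<open>1 = p * ieval B \<zeta>\<close>. Then \<open>f\<close> divides
      \<open>1 - smult p B\<close>, against \<open>not_unit_mod_prime\<close>.\<close>
    have "coprime (int (n ^ p)) (int p)"
      using p by (metis coprime_commute coprime_int_iff coprime_power_left_iff prime_imp_coprime)
    then obtain u v where "u * int (n ^ p) + v * int p = 1"
      using bezout_int[of "int (n ^ p)" "int p"] by auto
    then have "(1 :: complex) = of_int u * of_nat (n ^ p) + of_int v * of_nat p"
      by (metis of_int_1 of_int_add of_int_mult of_int_of_nat_eq)
    then have "ieval (1 - smult (int p) (smult u ((pderiv f * monom 1 1) ^ p * R) + [:v:])) \<zeta> = 0"
      unfolding np by (simp add: algebra_simps)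
    then show False
      using f(3) not_unit_mod_prime[of "int p" f] p(1) lc df by (meson prime_nat_int_transfer)
  qed
  moreover obtain h where "P = f * h" using f(3)[OF P] by (rule dvdE)
  ultimately show ?thesis by simp
qed

text \<open>The prime factors of \<open>k\<close> are taken one at a time. Each replaces
  \<open>\<zeta>\<close> by \<open>\<zeta> ^ p\<close>, again an \<open>n\<close>-th root of unity,
  so \<open>\<zeta>\<close> varies in the induction.\<close>

lemma conjugate_root:
  fixes \<zeta> :: complex
  assumes "coprime k n" "n > 0" "\<zeta> ^ n = 1" "ieval P \<zeta> = 0"
  shows "ieval P (\<zeta> ^ k) = 0"
proof (cases "k = 0")
  case True
  then have "n = 1" using assms by simp
  then show ?thesis using assms by simp
next
  case False
  then show ?thesis using assms
  proof (induction k arbitrary: \<zeta> rule: prime_divisors_induct)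
    case zero
    then show ?case by simp
  next
    case (unit k)
    then show ?case by simp
  next
    case (factor p k)
    have "\<not> p dvd n"
      using factor.prems(2) factor.hyps by (metis coprime_common_divisor dvd_triv_left not_prime_unit)
    then have "ieval P (\<zeta> ^ p) = 0"
      using conjugate_root_prime factor by blast
    moreover have "(\<zeta> ^ p) ^ n = 1" using factor.prems by (metis mult.commute power_mult power_one)
    ultimately show ?case using factor by (simp add: power_mult)
  qed
qed

section \<open>Roots of unity in cyclotomic fields\<close>

lemma cis_power_eq_1_iff:
  assumes "n > 0"
  shows "cis (2 * pi / real n) ^ j = 1 \<longleftrightarrow> n dvd j"
proof -
  have "cis (2 * pi / real n) ^ j = cis (real j * (2 * pi / real n))" by (rule Complex.DeMoivre)
  also have "\<dots> = 1 \<longleftrightarrow> (\<exists>i. real j = of_int i * real n)"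
    using assms by (simp add: cis_eq_1_iff field_simps)
  also have "\<dots> \<longleftrightarrow> (\<exists>i. int j = i * int n)"
    by (metis of_int_eq_iff of_int_mult of_int_of_nat_eq)
  also have "\<dots> \<longleftrightarrow> int n dvd int j" by (auto simp: dvd_def mult.commute)
  finally show ?thesis by simp
qed

text \<open>Elements of the field generated by \<open>z\<close> appear as quotients of
  \<open>ieval Q z\<close> by \<open>ieval P z\<close>. As \<open>x / y\<close> is in lowest terms,
  \<open>y = 1\<close> says that the given root of unity is an \<open>m\<close>-th one.\<close>

lemma root_of_unity_in_cyclotomic_field:
  fixes m x y :: nat and P Q :: "int poly"
  defines "z \<equiv> cis (2 * pi / real m)"
  assumes m: "even m" "m > 0" and xy: "coprime x y" "y > 0"
    and nz: "ieval P z \<noteq> 0"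
    and eq: "cis (2 * pi * real x / (real m * real y)) * ieval P z = ieval Q z"
  shows "y = 1"
proof (rule ccontr)
  assume "y \<noteq> 1"
  then obtain p where p: "prime p" "p dvd y" using prime_factor_nat by blast
  have "y \<noteq> 0" "\<not> p dvd 1" using xy(2) p(1) by (auto simp: not_prime_unit)
  then obtain y' where "y = p ^ multiplicity p y * y'" "\<not> p dvd y'"
    using multiplicity_decompose'[of y p] by blast
  then obtain y' e where y: "y = p ^ e * y'" "\<not> p dvd y'" by blast
  have y': "y' > 0" using y xy(2) by (cases y') auto
  have e: "e > 0" using y p(2) by (cases e) auto
  txt \<open>
    Conjugation by \<open>k\<close> fixes \<open>z\<close>, as \<open>k \<equiv> 1\<close> modulo \<open>m\<close>, but not all of the \<open>m * y\<close>-th roots of unity.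
    The factor \<open>j\<close> makes \<open>k\<close> prime to \<open>p\<close>; when \<open>j = 2\<close>, the prime \<open>p\<close> is odd because \<open>m\<close> is even.
  \<close>
  define j where "j = (if p dvd 1 + m * y' then 2 else 1 :: nat)"
  define k where "k = 1 + m * (j * y')"
  have pj: "\<not> p dvd j"
  proof
    assume "p dvd j"
    then have "p dvd 1 + m * y'" "p dvd 2" using p(1) by (auto simp: j_def split: if_splits)
    then have "p dvd 1" using m(1)
      by (metis dvd_add_left_iff dvd_mult2 dvd_trans)
    then show False using p(1) by (simp add: not_prime_unit)
  qed
  have pk: "\<not> p dvd k"
  proof
    assume *: "p dvd k"
    then have "j = 2" by (auto simp: j_def k_def split: if_splits)
    then have "p dvd 1 + m * y'" by (simp add: j_def split: if_splits)
    then have "p dvd 2 * (1 + m * y')" by (rule dvd_mult)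
    moreover have "2 * (1 + m * y') = k + 1" using \<open>j = 2\<close> by (simp add: k_def)
    ultimately have "p dvd 1" using * by (metis dvd_add_right_iff)
    then show False using p(1) by (simp add: not_prime_unit)
  qed
  have "coprime k d" if "d dvd m * (j * y')" for d
    unfolding k_def
    by (rule coprimeI) (metis that dvd_add_left_iff dvd_trans)
  then have "coprime k m" "coprime k y'" by simp_all
  moreover have "coprime k (p ^ e)"
    using pk p(1) by (metis coprime_commute coprime_power_right_iff prime_imp_coprime)
  ultimately have cop: "coprime k (m * y)" by (simp add: y)
  define \<zeta> where "\<zeta> = cis (2 * pi / real (m * y))"
  have zz: "z = \<zeta> ^ y" using xy(2) by (simp add: z_def \<zeta>_def Complex.DeMoivre field_simps)
  have ux: "cis (2 * pi * real x / (real m * real y)) = \<zeta> ^ x"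
    by (simp add: \<zeta>_def Complex.DeMoivre field_simps)
  have my: "m * y > 0" using m xy by simp
  \<comment> \<open>With \<open>z = \<zeta> ^ y\<close>, the relation \<open>eq\<close> says that
    \<open>?T\<close> vanishes at \<open>\<zeta>\<close>. Conjugation by \<open>k\<close> fixes
    \<open>z\<close> and thus changes only the factor \<open>\<zeta> ^ x\<close>.\<close>
  let ?T = "monom 1 x * (P \<circ>\<^sub>p monom 1 y) - Q \<circ>\<^sub>p monom 1 y"
  have "ieval ?T \<zeta> = 0" using eq by (simp add: zz ux)
  moreover have "\<zeta> ^ (m * y) = 1" using cis_power_eq_1_iff[OF my] by (simp add: \<zeta>_def)
  ultimately have "ieval ?T (\<zeta> ^ k) = 0" by (intro conjugate_root[OF cop my])
  moreover have "z ^ k = z"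
  proof -
    have "z ^ m = 1" using cis_power_eq_1_iff[OF m(2), of m] by (simp add: z_def)
    then show ?thesis by (simp add: k_def power_add power_mult)
  qed
  then have "(\<zeta> ^ k) ^ y = z" by (simp add: zz mult.commute flip: power_mult)
  ultimately have "\<zeta> ^ (k * x) * ieval P z = ieval Q z" by (simp add: power_mult)
  then have "\<zeta> ^ (k * x) = \<zeta> ^ x" using eq nz ux by (metis mult_right_cancel)
  moreover have "k * x = x + m * (j * y') * x" by (simp add: k_def algebra_simps)
  moreover have "\<zeta> ^ x \<noteq> 0" by (simp add: \<zeta>_def)
  ultimately have "\<zeta> ^ (m * (j * y') * x) = 1"
    by (metis mult_cancel_left mult.right_neutral power_add)
  then have "m * y dvd m * (j * y' * x)" using cis_power_eq_1_iff[OF my]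
    by (simp add: \<zeta>_def mult.assoc)
  \<comment> \<open>Cancelling \<open>x\<close>, which is prime to \<open>y\<close>, and then
    \<open>y'\<close> leaves \<open>p ^ e dvd j\<close>, impossible as \<open>e > 0\<close> and
    \<open>p\<close> does not divide \<open>j\<close>.\<close>
  then have "y dvd j * y' * x" using m(2) by simp
  then have "y dvd j * y'" using xy(1) by (metis coprime_commute coprime_dvd_mult_left_iff)
  then have "p ^ e dvd j" using y y' by simp
  then show False using pj e by (meson dvd_power dvd_trans)
qed

section \<open>Angles in the plane and the trigonometric relation\<close>

definition cross2 :: "real^2 \<Rightarrow> real^2 \<Rightarrow> real" where
  "cross2 u v = u $ 1 * v $ 2 - u $ 2 * v $ 1"

text \<open>Lagrange's identity writes \<open>(norm u * norm v)\<^sup>2\<close> as the sum of the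
  squares of inner and cross product. Values of \<open>arccos\<close> have nonnegative sine, hence
  the absolute value.\<close>

lemma norm_mult_cis_angle:
  fixes P Q R :: "real^2"
  assumes "P \<noteq> Q" "R \<noteq> Q"
  shows "of_real (norm (P - Q) * norm (R - Q)) * cis (angle_deg P Q R * pi / 180) =
    Complex ((P - Q) \<bullet> (R - Q)) \<bar>cross2 (P - Q) (R - Q)\<bar>"
proof -
  define u v where "u = P - Q" and "v = R - Q"
  define n where "n = norm u * norm v"
  have n: "n > 0" using assms by (simp add: n_def u_def v_def)
  define x where "x = u \<bullet> v / n"
  have "\<bar>u \<bullet> v\<bar> \<le> n" unfolding n_def by (rule Cauchy_Schwarz_ineq2)
  then have x: "\<bar>x\<bar> \<le> 1" using n by (simp add: x_def)
  have "n\<^sup>2 = (u \<bullet> u) * (v \<bullet> v)" by (simp add: n_def power_mult_distrib dot_square_norm)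
  also have "\<dots> = (u \<bullet> v)\<^sup>2 + (cross2 u v)\<^sup>2"
    by (simp add: cross2_def inner_vec_def sum_2 power2_eq_square algebra_simps)
  finally have n2: "n\<^sup>2 = (u \<bullet> v)\<^sup>2 + (cross2 u v)\<^sup>2" .
  have "n * sqrt (1 - x\<^sup>2) = sqrt (n\<^sup>2 * (1 - x\<^sup>2))" using n by (simp add: real_sqrt_mult)
  also have "n\<^sup>2 * (1 - x\<^sup>2) = (cross2 u v)\<^sup>2"
    using n n2 by (simp add: x_def power_divide right_diff_distrib)
  finally have s: "n * sqrt (1 - x\<^sup>2) = \<bar>cross2 u v\<bar>" by simp
  have "of_real n * cis (arccos x) = Complex (u \<bullet> v) \<bar>cross2 u v\<bar>"
    using x n s by (auto simp: complex_eq_iff cos_arccos_abs sin_arccos_abs) (simp add: x_def)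
  moreover have "angle_deg P Q R * pi / 180 = arccos x"
    by (simp add: angle_deg_def x_def n_def u_def v_def)
  ultimately show ?thesis by (simp add: n_def u_def v_def)
qed

lemma cis_double_mult_eq_cnj:
  assumes "Im (cis t * w) = 0"
  shows "cis (2 * t) * w = cnj w"
proof -
  have "cnj (cis t * w) = cis t * w" using assms by (simp add: complex_eq_iff)
  then have "cis t * (cis t * w) = cis t * cnj (cis t) * cnj w" by simp
  also have "cis t * cnj (cis t) = 1" by (simp add: cis_mult cis_cnj)
  finally show ?thesis by (simp add: cis_mult flip: mult.assoc)
qed

text \<open>
  Here \<open>s = AE / AB\<close> and \<open>t = AD / AC\<close>, and the last six hypotheses are the inner and cross products of
  the sides enclosing the angles \<open>DBC\<close>, \<open>ECB\<close>, \<open>EDB\<close>, divided by \<open>AB\<^sup>2\<close>.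
\<close>

lemma
  fixes \<alpha> \<beta> \<gamma> \<theta> s t rb rc r\<theta> :: real
  defines "W \<equiv> cis (\<alpha> - \<gamma>) + cis (- \<alpha> - \<gamma>) + cis \<gamma> + cis (- \<gamma>) +
    cis (- \<gamma> - 2 * \<beta>) - cis (\<gamma> - 2 * \<beta>)"
  assumes st: "0 < s" "s < 1" "0 < t" "t < 1" and \<alpha>: "sin \<alpha> > 0"
    and r: "rb > 0" "rc > 0" "r\<theta> > 0"
    and \<beta>: "rb * cos \<beta> = (1 + t) * (1 - cos \<alpha>)" "rb * sin \<beta> = (1 - t) * sin \<alpha>"
    and \<gamma>: "rc * cos \<gamma> = (1 + s) * (1 - cos \<alpha>)" "rc * sin \<gamma> = (1 - s) * sin \<alpha>"
    and \<theta>: "r\<theta> * cos \<theta> = s + t\<^sup>2 - t * (1 + s) * cos \<alpha>" "r\<theta> * sin \<theta> = t * (1 - s) * sin \<alpha>"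
  shows isosceles_relation: "cis (2 * \<theta>) * W = cnj W" and isosceles_relation_nz: "W \<noteq> 0"
proof -
  define k m where "k = cos \<alpha>" and "m = sin \<alpha>"
  have km: "m * m = 1 - k * k" using sin_cos_squared_add[of \<alpha>]
    by (simp add: k_def m_def power2_eq_square)
  \<comment> \<open>This is half of \<open>Im (cis \<theta> * W)\<close>, namely cos \<alpha> sin
    (\<theta> - \<gamma>) + sin \<theta> cos \<gamma> - sin \<gamma> cos (\<theta> - 2
    \<beta>).\<close>
  let ?F = "k * (sin \<theta> * cos \<gamma> - cos \<theta> * sin \<gamma>) + sin \<theta> * cos \<gamma> -
     sin \<gamma> * (cos (2 * \<beta>) * cos \<theta> + sin (2 * \<beta>) * sin \<theta>)"
  have bb: "(rb * cos \<beta>)\<^sup>2 + (rb * sin \<beta>)\<^sup>2 = rb\<^sup>2"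
    by (simp add: power_mult_distrib flip: distrib_left)
  have c2: "rb\<^sup>2 * cos (2 * \<beta>) = (rb * cos \<beta>)\<^sup>2 - (rb * sin \<beta>)\<^sup>2"
    by (simp add: cos_double power_mult_distrib right_diff_distrib)
  have s2: "rb\<^sup>2 * sin (2 * \<beta>) = 2 * (rb * cos \<beta>) * (rb * sin \<beta>)"
    by (simp add: sin_double power2_eq_square)
  \<comment> \<open>The radii are multiplied in, \<open>rb\<close> twice because of the double
    angle. Substituting the hypotheses leaves a polynomial in \<open>s\<close>, \<open>t\<close>,
    \<open>k\<close>, \<open>m\<close> that vanishes modulo
    \<open>m * m = 1 - k * k\<close>.\<close>
  have "rb\<^sup>2 * (rc * (r\<theta> * ?F)) =
      rb\<^sup>2 * (k * ((r\<theta> * sin \<theta>) * (rc * cos \<gamma>) - (r\<theta> * cos \<theta>) * (rc * sin \<gamma>)) +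
        (r\<theta> * sin \<theta>) * (rc * cos \<gamma>)) -
      (rc * sin \<gamma>) * ((rb\<^sup>2 * cos (2 * \<beta>)) * (r\<theta> * cos \<theta>) + (rb\<^sup>2 * sin (2 * \<beta>)) * (r\<theta> * sin \<theta>))"
    by (simp add: algebra_simps)
  also have "\<dots> = 0"
    unfolding c2 s2 unfolding bb[symmetric] unfolding \<beta> \<gamma> \<theta> k_def[symmetric] m_def[symmetric]
    using km by algebra
  finally have F: "?F = 0" using r by simp
  have "Im (cis \<theta> * W) = sin (\<theta> + (\<alpha> - \<gamma>)) + sin (\<theta> + (- \<alpha> - \<gamma>)) + sin (\<theta> + \<gamma>) + sin (\<theta> - \<gamma>) +
      sin (\<theta> + (- \<gamma> - 2 * \<beta>)) - sin (\<theta> + (\<gamma> - 2 * \<beta>))"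
    by (simp add: W_def distrib_left right_diff_distrib cis_mult)
  also have "\<dots> = 2 * ?F"
    by (simp add: k_def sin_add sin_diff cos_add cos_diff algebra_simps)
  also have "\<dots> = 0" using F by simp
  finally show "cis (2 * \<theta>) * W = cnj W" by (rule cis_double_mult_eq_cnj)
  \<comment> \<open>It remains to see that
    \<open>Im W = - 2 * sin \<gamma> * (k + cos (2 * \<beta>))\<close> is nonzero:
    \<open>sin \<gamma>\<close> is positive because \<open>s < 1\<close>, the last factor because
    \<open>t > 0\<close>.\<close>
  have k1: "k < 1"
  proof -
    have "m * m > 0" using \<alpha> by (simp add: m_def)
    then have "k * k < 1" using km by simp
    then show ?thesis by (metis abs_square_less_1 abs_less_iff power2_eq_square)
  qed
  have "rb\<^sup>2 * (k + cos (2 * \<beta>)) =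
      k * ((rb * cos \<beta>)\<^sup>2 + (rb * sin \<beta>)\<^sup>2) + ((rb * cos \<beta>)\<^sup>2 - (rb * sin \<beta>)\<^sup>2)"
    unfolding bb c2[symmetric] by (simp add: algebra_simps)
  also have "\<dots> = 4 * t * (m * m) * (1 - k)"
    unfolding \<beta> k_def[symmetric] m_def[symmetric] using km by algebra
  also have "\<dots> > 0" using k1 \<alpha> st by (simp add: m_def)
  finally have "k + cos (2 * \<beta>) > 0" using r(1) by (simp add: zero_less_mult_iff)
  moreover have "sin \<gamma> > 0"
  proof -
    have "rc * sin \<gamma> > 0" using \<gamma>(2) st \<alpha> by simp
    then show ?thesis using r(2) by (simp add: zero_less_mult_iff)
  qed
  moreover have "Im W = - 2 * sin \<gamma> * (k + cos (2 * \<beta>))"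
    by (simp add: W_def k_def sin_add sin_diff cos_add cos_diff algebra_simps)
  ultimately show "W \<noteq> 0" by fastforce
qed

section \<open>Angles of integral degree measure\<close>

lemma cis_degree_ieval:
  "\<exists>P. cis (of_int i * pi / 180) = ieval P (cis (2 * pi / real 360))"
proof -
  \<comment> \<open>Reducing modulo 360 makes the exponent of the monomial a natural number.\<close>
  define n where "n = nat (i mod 360)"
  have "real_of_int i = 360 * of_int (i div 360) + of_int (i mod 360)"
    by (metis mult_div_mod_eq of_int_add of_int_mult of_int_numeral)
  then have i: "real_of_int i = 360 * of_int (i div 360) + real n" by (simp add: n_def)
  have "cis (of_int i * pi / 180) = cis (2 * pi * of_int (i div 360)) * cis (real n * (2 * pi / real 360))"
    by (simp add: i cis_mult algebra_simps add_divide_distrib)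
  also have "\<dots> = ieval (monom 1 n) (cis (2 * pi / real 360))"
    by (simp add: Complex.DeMoivre)
  finally show ?thesis by blast
qed

lemma snd_quotient_of_le_2:
  assumes "2 * r = of_int x"
  shows "snd (quotient_of r) \<le> 2"
proof -
  obtain p q where pq: "quotient_of r = (p, q)" by force
  have q: "q > 0" and c: "coprime p q" and r: "r = of_int p / of_int q"
    using pq by (auto simp: quotient_of_denom_pos quotient_of_coprime quotient_of_div)
  have "(of_int (2 * p) :: rat) = of_int (x * q)"
    using assms r q by (simp add: field_simps)
  then have "2 * p = x * q" by (simp only: of_int_eq_iff)
  then have "q dvd 2 * p" by simp
  then have "q dvd 2" using c by (metis coprime_commute coprime_dvd_mult_left_iff)
  then show ?thesis using pq zdvd_imp_le by fastforce
qed

text \<open>With \<open>2 * r = x / y\<close> in lowest terms the double angle is 2 pi x / (360 y),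
  to which \<open>root_of_unity_in_cyclotomic_field\<close> applies; \<open>r \<ge> 0\<close> makes
  the numerator a natural number.\<close>

lemma double_angle_integral:
  fixes r :: rat and P Q :: "int poly"
  defines "z \<equiv> cis (2 * pi / real 360)"
  assumes r: "r \<ge> 0" and nz: "ieval P z \<noteq> 0"
    and eq: "cis (2 * (of_rat r * pi / 180)) * ieval P z = ieval Q z"
  shows "snd (quotient_of r) \<le> 2"
proof -
  obtain x' y' where xy: "quotient_of (2 * r) = (x', y')" by force
  have y': "y' > 0" and c: "coprime x' y'" and r2: "2 * r = of_int x' / of_int y'"
    using xy by (auto simp: quotient_of_denom_pos quotient_of_coprime quotient_of_div)
  have x': "x' \<ge> 0"
    using r r2 y' by (metis divide_neg_pos mult_nonneg_nonneg not_le of_int_0_less_iff of_int_less_0_iff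
        zero_le_numeral)
  define x y where "x = nat x'" and "y = nat y'"
  have xyi: "x' = int x" "y' = int y" using x' y' by (simp_all add: x_def y_def)
  have "2 * of_rat r = (of_rat (2 * r) :: real)" by (simp add: of_rat_mult)
  also have "\<dots> = real x / real y" by (simp add: r2 xyi of_rat_divide)
  finally have "2 * (of_rat r * pi / 180) = 2 * pi * real x / (real 360 * real y)"
    by (simp add: field_simps)
  then have "y = 1"
    using root_of_unity_in_cyclotomic_field[of 360 x y P Q] nz eq c y'
    by (simp add: z_def xyi)
  then show ?thesis using r2 snd_quotient_of_le_2[of r x'] by (simp add: xyi)
qed

section \<open>The configuration in terms of the vectors AB and AC\<close>

lemma cross2_scaleR_diff:
  "cross2 (x *\<^sub>R u - y *\<^sub>R v) (x' *\<^sub>R u - y' *\<^sub>R v) = (y * x' - x * y') * cross2 u v"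
  by (simp add: cross2_def algebra_simps)

lemma inner_scaleR_diff:
  fixes u v :: "'a::real_inner"
  assumes "u \<bullet> u = q" "v \<bullet> v = q" "u \<bullet> v = q * k"
  shows "(x *\<^sub>R u - y *\<^sub>R v) \<bullet> (x' *\<^sub>R u - y' *\<^sub>R v) = q * (x * x' + y * y' - (x * y' + y * x') * k)"
proof -
  have "v \<bullet> u = q * k" using assms(3) by (simp add: inner_commute)
  then show ?thesis using assms by (simp add: inner_diff_left inner_diff_right algebra_simps)
qed

lemma cross2_eq_0_collinear:
  assumes "cross2 (B - A) (C - A) = 0"
  shows "collinear {A, B, C}"
proof -
  have "\<exists>c. C - A = c *\<^sub>R (B - A)" if ne: "B \<noteq> A"
  proof -
    define u v where "u = B - A" and "v = C - A"
    have uv: "u $ 1 * v $ 2 = u $ 2 * v $ 1" using assms by (simp add: cross2_def u_def v_def)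
    have "u $ 1 \<noteq> 0 \<or> u $ 2 \<noteq> 0" using ne by (auto simp: u_def vec_eq_iff forall_2)
    then have "\<exists>c. v = c *\<^sub>R u"
    proof
      assume "u $ 1 \<noteq> 0"
      then show ?thesis using uv by (intro exI[of _ "v $ 1 / u $ 1"]) (auto simp: vec_eq_iff forall_2 field_simps)
    next
      assume "u $ 2 \<noteq> 0"
      then show ?thesis using uv by (intro exI[of _ "v $ 2 / u $ 2"]) (auto simp: vec_eq_iff forall_2 field_simps)
    qed
    then show ?thesis by (simp add: u_def v_def)
  qed
  then have "collinear {0, B - A, C - A}"
    by (cases "B = A") (auto simp: collinear_lemma)
  moreover have "collinear {B, A, C} = collinear {0, B - A, C - A}"
    by (rule collinear_3) simp
  ultimately show ?thesis by (simp add: insert_commute)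
qed

theorem theorem1:
  fixes A B C D E :: "real ^ 2"
    and a b c \<theta> :: real
    and r :: rat
  assumes triangle: "\<not> collinear {A, B, C}"
    and isosceles: "dist A B = dist A C"
    and D: "D \<in> open_segment A C"
    and E: "E \<in> open_segment A B"
    and a: "a = angle_deg B A C"
    and b: "b = angle_deg D B C"
    and c: "c = angle_deg E C B"
    and theta: "\<theta> = angle_deg E D B"
    and integral: "a \<in> \<int>" "b \<in> \<int>" "c \<in> \<int>"
    and rational: "\<theta> = of_rat r"
  shows "snd (quotient_of r) \<le> 2"
proof -
  define u v where "u = B - A" and "v = C - A"
  define q where "q = u \<bullet> u"
  have AB: "A \<noteq> B" "A \<noteq> C" "B \<noteq> C" using triangle by (auto simp: insert_absorb)
  have q: "q > 0" using AB by (simp add: q_def u_def)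
  have nuv: "norm u = norm v" using isosceles by (simp add: u_def v_def dist_norm norm_minus_commute)
  then have vv: "v \<bullet> v = q" by (simp add: q_def dot_square_norm)
  have nn: "norm u * norm v = q" using nuv by (simp add: q_def dot_square_norm power2_eq_square)
  define \<alpha> \<beta> \<gamma> \<phi> where "\<alpha> = a * pi / 180" and "\<beta> = b * pi / 180" and "\<gamma> = c * pi / 180"
    and "\<phi> = \<theta> * pi / 180"
  define k where "k = cos \<alpha>"
  have "of_real q * cis \<alpha> = Complex (u \<bullet> v) \<bar>cross2 u v\<bar>"
    using norm_mult_cis_angle[OF AB(1,2)[symmetric]]
    unfolding \<alpha>_def a u_def[symmetric] v_def[symmetric] nn .
  then have uv: "u \<bullet> v = q * k" and X: "\<bar>cross2 u v\<bar> = q * sin \<alpha>"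
    by (auto simp: complex_eq_iff k_def)
  note inner = inner_scaleR_diff[OF q_def[symmetric] vv uv]
  have "cross2 u v \<noteq> 0" using cross2_eq_0_collinear triangle by (auto simp: u_def v_def)
  then have "q * sin \<alpha> > 0" using X by linarith
  then have \<alpha>: "sin \<alpha> > 0" using q by (simp add: zero_less_mult_iff)
  obtain t where t: "0 < t" "t < 1" and Dt: "D = (1 - t) *\<^sub>R A + t *\<^sub>R C"
    using D by (auto simp: in_segment)
  obtain s where s: "0 < s" "s < 1" and Es: "E = (1 - s) *\<^sub>R A + s *\<^sub>R B"
    using E by (auto simp: in_segment)
  \<comment> \<open>The signs are arranged so that every vector has the shape matched by
    \<open>inner_scaleR_diff\<close> and \<open>cross2_scaleR_diff\<close>.\<close>
  have vecs: "D - B = (- 1) *\<^sub>R u - (- t) *\<^sub>R v" "C - B = (- 1) *\<^sub>R u - (- 1) *\<^sub>R v"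
    "E - C = s *\<^sub>R u - 1 *\<^sub>R v" "B - C = 1 *\<^sub>R u - 1 *\<^sub>R v"
    "E - D = s *\<^sub>R u - t *\<^sub>R v" "B - D = 1 *\<^sub>R u - t *\<^sub>R v"
    by (simp_all add: Dt Es u_def v_def algebra_simps)
  have ne: "D \<noteq> B" "E \<noteq> C" "E \<noteq> D"
  proof -
    have "cross2 (D - B) (C - B) \<noteq> 0" "cross2 (E - C) (B - C) \<noteq> 0" "cross2 (E - D) (B - D) \<noteq> 0"
      using \<open>cross2 u v \<noteq> 0\<close> s t unfolding vecs cross2_scaleR_diff by auto
    then show "D \<noteq> B" "E \<noteq> C" "E \<noteq> D" by (auto simp: cross2_def)
  qed
  have neB: "B \<noteq> D" using ne by simp
  define rb rc rt where "rb = norm (D - B) * norm (C - B) / q" and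
    "rc = norm (E - C) * norm (B - C) / q" and "rt = norm (E - D) * norm (B - D) / q"
  have r: "rb > 0" "rc > 0" "rt > 0" using ne neB AB q by (simp_all add: rb_def rc_def rt_def)
  have polar: "R / q * cos x = X' \<and> R / q * sin x = \<bar>Y\<bar> * sin \<alpha>"
    if "of_real R * cis x = Complex (q * X') \<bar>Y * cross2 u v\<bar>" for R x X' Y
    using that q by (simp add: complex_eq_iff abs_mult X field_simps)
  have b': "rb * cos \<beta> = (1 + t) * (1 - cos \<alpha>)" "rb * sin \<beta> = (1 - t) * sin \<alpha>"
    using polar[OF norm_mult_cis_angle[OF ne(1) AB(3)[symmetric],
          unfolded vecs inner cross2_scaleR_diff], folded vecs, folded rb_def b, folded \<beta>_def] t
    by (simp_all add: k_def algebra_simps)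
  have c': "rc * cos \<gamma> = (1 + s) * (1 - cos \<alpha>)" "rc * sin \<gamma> = (1 - s) * sin \<alpha>"
    using polar[OF norm_mult_cis_angle[OF ne(2) AB(3),
          unfolded vecs inner cross2_scaleR_diff], folded vecs, folded rc_def c, folded \<gamma>_def] s
    by (simp_all add: k_def algebra_simps)
  have "\<bar>t * 1 - s * t\<bar> = t * (1 - s)" using s t by (simp add: algebra_simps)
  then have t': "rt * cos \<phi> = s + t\<^sup>2 - t * (1 + s) * cos \<alpha>" "rt * sin \<phi> = t * (1 - s) * sin \<alpha>"
    using polar[OF norm_mult_cis_angle[OF ne(3) neB,
          unfolded vecs inner cross2_scaleR_diff], folded vecs, folded rt_def theta, folded \<phi>_def]
    by (simp_all add: k_def power2_eq_square algebra_simps)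
  define W where "W = cis (\<alpha> - \<gamma>) + cis (- \<alpha> - \<gamma>) + cis \<gamma> + cis (- \<gamma>) +
    cis (- \<gamma> - 2 * \<beta>) - cis (\<gamma> - 2 * \<beta>)"
  note rel = s t \<alpha> r b' c' t'
  have eq: "cis (2 * \<phi>) * W = cnj W" unfolding W_def by (rule isosceles_relation[OF rel])
  have W0: "W \<noteq> 0" unfolding W_def by (rule isosceles_relation_nz[OF rel])
  \<comment> \<open>\<open>R\<close> consists of the integer polynomials in the 360th root of unity.
    Both \<open>W\<close> and \<open>cnj W\<close> are signed sums of \<open>cis\<close> at angles
    in \<open>Z\<close>, those of integral degree measure, so they lie in \<open>R\<close>.\<close>
  define R where "R = range (\<lambda>P. ieval P (cis (2 * pi / real 360)))"
  have R: "x + y \<in> R" "x - y \<in> R" if "x \<in> R" "y \<in> R" for x y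
    using that unfolding R_def image_iff by (metis UNIV_I ieval_add, metis UNIV_I ieval_diff)
  define Z where "Z = {x. x * 180 / pi \<in> \<int>}"
  have Z: "\<alpha> \<in> Z" "\<beta> \<in> Z" "\<gamma> \<in> Z"
    using integral by (simp_all add: Z_def \<alpha>_def \<beta>_def \<gamma>_def)
  have Z_diff: "x - y \<in> Z" if "x \<in> Z" "y \<in> Z" for x y
    using that by (simp add: Z_def left_diff_distrib diff_divide_distrib)
  have Z_minus: "- x \<in> Z" if "x \<in> Z" for x using that by (simp add: Z_def)
  have Z_double: "2 * x \<in> Z" if "x \<in> Z" for x
    using Z_diff[OF that Z_minus[OF that]] by simp
  have cisR: "cis x \<in> R" if x: "x \<in> Z" for x
  proof -
    obtain n where "x * 180 / pi = of_int n" using x unfolding Z_def mem_Collect_eq by (rule Ints_cases)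
    then have "x = of_int n * pi / 180" by (simp add: field_simps)
    then show ?thesis using cis_degree_ieval[of n] unfolding R_def by blast
  qed
  have "W \<in> R" unfolding W_def by (intro R cisR Z_diff Z_minus Z_double Z)
  moreover have "cnj W \<in> R" unfolding W_def complex_cnj_add complex_cnj_diff cis_cnj
    by (intro R cisR Z_diff Z_minus Z_double Z)
  ultimately obtain P Q where "W = ieval P (cis (2 * pi / real 360))"
      "cnj W = ieval Q (cis (2 * pi / real 360))"
    by (auto simp: R_def)
  moreover have "r \<ge> 0"
  proof -
    define d where "d = (E - D) \<bullet> (B - D) / (norm (E - D) * norm (B - D))"
    have "\<bar>d\<bar> \<le> 1" using ne neB by (simp add: d_def abs_mult Cauchy_Schwarz_ineq2)
    then have "arccos d \<ge> 0" by (intro arccos_lbound) linarith+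
    then have "\<theta> \<ge> 0" by (simp add: theta angle_deg_def d_def)
    then show ?thesis using rational by simp
  qed
  ultimately show ?thesis using double_angle_integral[of r P Q] eq W0
    by (simp add: \<phi>_def rational)
qed

end
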